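(* Consider the variable-selection problem with $m\ge 1$ candidate variables and observed data $\mathbf{Y}$, with models $M_{\gamma}$, $\gamma\in\{0,1\}^m$, and marginal likelihoods $f(\mathbf{Y}\mid M_\gamma)$. If the null model $M_0$ has the strictly largest marginal likelihood, i.e. $f(\mathbf{Y}\mid M_0)>f(\mathbf{Y}\mid M_\gamma)$ for all $\gamma\neq(0,\dots,0)$, then the Type-II maximum likelihood estimate of $p$ is $\hat p=0$. Similarly, if the full model $M_F$ has the strictly largest marginal likelihood, i.e. $f(\mathbf{Y}\mid M_F)>f(\mathbf{Y}\mid M_\gamma)$ for all $\gamma\neq(1,\dots,1)$, then $\hat p=1$.
   Context: Models are indexed by binary vectors $\gamma\in\{0,1\}^m$; $k_\gamma=\sum_{i=1}^m\gamma_i$ is the number of included variables. $M_0$ (null model) corresponds to $\gamma=(0,\dots,0)$ and $M_F$ (full model) to $\gamma=(1,\dots,1)$. Each model has a marginal likelihood $f(\mathbf{Y}\mid M_\gamma)\ge 0$ (the likelihood integrated over the prior for the parameters of that model), which does not depend on $p$. Given a prior inclusion probability $p\in[0,1]$, the prior probability of a model is $p(M_\gamma\mid p)=p^{k_\gamma}(1-p)^{m-k_\gamma}$ (with the convention $0^0=1$). The Type-II maximum likelihood (empirical-Bayes) estimate of $p$ is $$\hat p=\arg\max_{p\in[0,1]}\ \sum_{\gamma\in\{0,1\}^m}p(M_\gamma\mid p)\,f(\mathbf{Y}\mid M_\gamma).$$ *)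

theory Defs
  imports Complex_Main "HOL-Library.FuncSet"
begin

text \<open>Binary vectors of length \<open>m\<close>, as extensional functions on the index set \<open>{1..m}\<close>, so that
  distinct elements of \<open>models m\<close> are distinct vectors.\<close>

definition models :: "nat \<Rightarrow> (nat \<Rightarrow> nat) set" where
  "models m = ({1..m} \<rightarrow>\<^sub>E {0, 1})"

definition null_model :: "nat \<Rightarrow> nat \<Rightarrow> nat" where
  "null_model m = (\<lambda>i\<in>{1..m}. 0)"

definition full_model :: "nat \<Rightarrow> nat \<Rightarrow> nat" where
  "full_model m = (\<lambda>i\<in>{1..m}. 1)"

definition model_size :: "nat \<Rightarrow> (nat \<Rightarrow> nat) \<Rightarrow> nat" where
  "model_size m \<gamma> = (\<Sum>i=1..m. \<gamma> i)"

text \<open>On \<open>models m\<close> the size is at most \<open>m\<close>, so the subtraction does not truncate; \<open>0 ^ 0 = 1\<close>.\<close>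

definition model_prior :: "nat \<Rightarrow> real \<Rightarrow> (nat \<Rightarrow> nat) \<Rightarrow> real" where
  "model_prior m p \<gamma> = p ^ model_size m \<gamma> * (1 - p) ^ (m - model_size m \<gamma>)"

text \<open>In the following, \<open>f \<gamma>\<close> is the marginal likelihood of the model \<open>\<gamma>\<close> at the observed data.\<close>

definition type_II_likelihood :: "nat \<Rightarrow> ((nat \<Rightarrow> nat) \<Rightarrow> real) \<Rightarrow> real \<Rightarrow> real" where
  "type_II_likelihood m f p = (\<Sum>\<gamma>\<in>models m. model_prior m p \<gamma> * f \<gamma>)"

text \<open>A maximizer need not be unique for general \<open>f\<close>, hence a predicate. That the estimate is \<open>c\<close> means
  that \<open>c\<close> is the one and only maximizer.\<close>

definition is_type_II_mle :: "nat \<Rightarrow> ((nat \<Rightarrow> nat) \<Rightarrow> real) \<Rightarrow> real \<Rightarrow> bool" where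
  "is_type_II_mle m f = is_arg_max (type_II_likelihood m f) (\<lambda>p. p \<in> {0..1})"

end

theory Submission
  imports Defs
begin

text \<open>The prior probabilities of the models sum to 1, so the type-II likelihood at \<open>p\<close> is a weighted
  average of the marginal likelihoods. At \<open>p = 0\<close> (resp. \<open>p = 1\<close>) all the weight sits on the null
  (resp. full) model; for every other \<open>p\<close> the opposite extreme model has positive weight, so the
  average lies strictly below the largest marginal likelihood.\<close>

lemma finite_models [simp]: "finite (models m)"
  unfolding models_def by (intro finite_PiE) auto

lemma null_model_in_models [simp]: "null_model m \<in> models m"
  by (auto simp: models_def null_model_def)

lemma full_model_in_models [simp]: "full_model m \<in> models m"
  by (auto simp: models_def full_model_def)

lemma model_size_null [simp]: "model_size m (null_model m) = 0"
  by (simp add: model_size_def null_model_def)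

lemma model_size_full [simp]: "model_size m (full_model m) = m"
  by (simp add: model_size_def full_model_def)

text \<open>The sizes 0 and \<open>m\<close> tell the two models apart; for \<open>m = 0\<close>
  both are the empty vector.\<close>

lemma null_model_neq_full_model:
  assumes "1 \<le> m"
  shows "null_model m \<noteq> full_model m"
  using assms model_size_null model_size_full by (metis not_one_le_zero)

lemma model_prior_nonneg:
  assumes "p \<in> {0..1}"
  shows "0 \<le> model_prior m p \<gamma>"
  using assms by (simp add: model_prior_def)

text \<open>Independent inclusion of each variable with probability \<open>p\<close>: grouping equal
  factors counts \<open>p\<close> once per entry 1 and \<open>1 - p\<close> once per entry 0. The
  coordinatewise form is what lets the sum over all models factor.\<close>

lemma model_prior_eq_prod:
  assumes "\<gamma> \<in> models m"
  shows "model_prior m p \<gamma> = (\<Prod>i=1..m. if \<gamma> i = 1 then p else 1 - p)"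
proof -
  let ?A = "{i \<in> {1..m}. \<gamma> i = 1}"
  have "\<gamma> i = (if \<gamma> i = 1 then 1 else 0)" if "i \<in> {1..m}" for i
    using assms that by (auto simp: models_def PiE_def Pi_def)
  then have "model_size m \<gamma> = (\<Sum>i=1..m. if \<gamma> i = 1 then 1 else 0)"
    unfolding model_size_def by (rule sum.cong[OF refl])
  also have "\<dots> = card ?A"
    by (simp add: sum.If_cases Int_def)
  finally have size: "model_size m \<gamma> = card ?A" .
  \<comment> \<open>\<open>prod.If_cases\<close> produces the index set of the factors
    \<open>1 - p\<close> in the form on the left; the right side is the one whose cardinality is
    computed next.\<close>
  have compl: "{1..m} \<inter> - {i. \<gamma> i = 1} = {1..m} - ?A"
    by auto
  have "card ({1..m} - ?A) = m - card ?A"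
    by (subst card_Diff_subset) auto
  then show ?thesis
    unfolding model_prior_def size
    by (simp only: prod.If_cases finite_atLeastAtMost prod_constant compl) (simp add: Int_def)
qed

text \<open>By distributivity the sum over all vectors is a product over coordinates, each factor
  being \<open>(1 - p) + p = 1\<close>. This is a polynomial identity, valid for every real
  \<open>p\<close>.\<close>

lemma sum_model_prior: "(\<Sum>\<gamma>\<in>models m. model_prior m p \<gamma>) = 1"
proof -
  have "(\<Sum>\<gamma>\<in>models m. model_prior m p \<gamma>)
      = (\<Sum>\<gamma>\<in>{1..m} \<rightarrow>\<^sub>E {0, 1::nat}. \<Prod>i=1..m. if \<gamma> i = 1 then p else 1 - p)"
    unfolding models_def[symmetric] by (intro sum.cong) (auto simp: model_prior_eq_prod)
  also have "\<dots> = (\<Prod>i=1..m. \<Sum>b\<in>{0, 1::nat}. if b = 1 then p else 1 - p)"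
    by (rule prod_sum_PiE[symmetric]) auto
  finally show ?thesis
    by simp
qed

text \<open>Replacing each \<open>f \<gamma>\<close> by \<open>M\<close> never lowers a term and
  strictly raises the one at \<open>\<eta>\<close>; since the weights sum to 1, the new sum is
  \<open>M\<close>.\<close>

lemma type_II_likelihood_less:
  assumes p: "p \<in> {0..1}"
    and le: "\<And>\<gamma>. \<gamma> \<in> models m \<Longrightarrow> f \<gamma> \<le> M"
    and \<eta>: "\<eta> \<in> models m" "f \<eta> < M" "0 < model_prior m p \<eta>"
  shows "type_II_likelihood m f p < M"
proof -
  have "type_II_likelihood m f p < (\<Sum>\<gamma>\<in>models m. model_prior m p \<gamma> * M)"
    unfolding type_II_likelihood_def
  proof (rule sum_strict_mono_ex1)
    show "\<forall>\<gamma>\<in>models m. model_prior m p \<gamma> * f \<gamma> \<le> model_prior m p \<gamma> * M"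
      using le model_prior_nonneg[OF p] by (auto intro: mult_left_mono)
    show "\<exists>\<gamma>\<in>models m. model_prior m p \<gamma> * f \<gamma> < model_prior m p \<gamma> * M"
      using \<eta> by (auto intro!: bexI[of _ \<eta>])
  qed simp
  also have "\<dots> = M"
    by (simp add: sum_model_prior flip: sum_distrib_right)
  finally show ?thesis .
qed

text \<open>Weight 1 on \<open>\<delta>\<close> leaves total 0 for the other weights, which are
  nonnegative and hence all vanish.\<close>

lemma type_II_likelihood_degenerate:
  assumes p: "p \<in> {0..1}" and \<delta>: "\<delta> \<in> models m" "model_prior m p \<delta> = 1"
  shows "type_II_likelihood m f p = f \<delta>"
proof -
  have "(\<Sum>\<gamma>\<in>models m - {\<delta>}. model_prior m p \<gamma>) = 0"
    using sum_model_prior[of m p] \<delta> by (simp add: sum.remove[of _ \<delta>])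
  then have "\<forall>\<gamma>\<in>models m - {\<delta>}. model_prior m p \<gamma> = 0"
    using model_prior_nonneg[OF p] by (subst (asm) sum_nonneg_eq_0_iff) auto
  then show ?thesis
    unfolding type_II_likelihood_def using \<delta> by (simp add: sum.remove[of _ \<delta>])
qed

text \<open>Common form of both claims: \<open>c\<close> is the endpoint where the prior is
  concentrated on the best model \<open>\<delta>\<close>, and \<open>\<eta>\<close> is a competitor
  that keeps positive weight at every other \<open>p\<close>.\<close>

lemma is_type_II_mle_iff:
  assumes c: "c \<in> {0..1}"
    and \<delta>: "\<delta> \<in> models m" "model_prior m c \<delta> = 1"
    and best: "\<forall>\<gamma>\<in>models m. \<gamma> \<noteq> \<delta> \<longrightarrow> f \<delta> > f \<gamma>"
    and \<eta>: "\<eta> \<in> models m" "\<eta> \<noteq> \<delta>"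
    and pos: "\<And>p. p \<in> {0..1} \<Longrightarrow> p \<noteq> c \<Longrightarrow> 0 < model_prior m p \<eta>"
  shows "is_type_II_mle m f p \<longleftrightarrow> p = c"
proof -
  have le: "f \<gamma> \<le> f \<delta>" if "\<gamma> \<in> models m" for \<gamma>
    using best that by (cases "\<gamma> = \<delta>") auto
  have less: "type_II_likelihood m f q < type_II_likelihood m f c"
    if "q \<in> {0..1}" "q \<noteq> c" for q
    unfolding type_II_likelihood_degenerate[OF c \<delta>]
    using that le best \<eta> pos by (intro type_II_likelihood_less[where \<eta> = \<eta>]) auto
  \<comment> \<open>The strict inequality \<open>less\<close> serves twice: no point beats
    \<open>c\<close>, and \<open>c\<close> beats every other point.\<close>
  show ?thesis
    unfolding is_type_II_mle_def is_arg_max_def using c less by (metis less_asym)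
qed

theorem lemma4p1:
  fixes m :: nat
    and f :: "'y \<Rightarrow> (nat \<Rightarrow> nat) \<Rightarrow> real"
    and Y :: 'y
  assumes "1 \<le> m"
    and "\<And>\<gamma>. \<gamma> \<in> models m \<Longrightarrow> 0 \<le> f Y \<gamma>"
  shows "((\<forall>\<gamma>\<in>models m. \<gamma> \<noteq> null_model m \<longrightarrow> f Y (null_model m) > f Y \<gamma>)
            \<longrightarrow> (\<forall>p. is_type_II_mle m (f Y) p \<longleftrightarrow> p = 0))
       \<and> ((\<forall>\<gamma>\<in>models m. \<gamma> \<noteq> full_model m \<longrightarrow> f Y (full_model m) > f Y \<gamma>)
            \<longrightarrow> (\<forall>p. is_type_II_mle m (f Y) p \<longleftrightarrow> p = 1))"
proof (intro conjI impI allI)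
  note neq = null_model_neq_full_model[OF \<open>1 \<le> m\<close>]
  fix p
  \<comment> \<open>At 0 the null model has weight 1 because \<open>0 ^ 0 = 1\<close>; the full
    model has weight \<open>p ^ m\<close>, positive for \<open>p > 0\<close>. The second claim
    exchanges the roles, with weight \<open>(1 - p) ^ m\<close> for the null model.\<close>
  show "is_type_II_mle m (f Y) p \<longleftrightarrow> p = 0"
    if "\<forall>\<gamma>\<in>models m. \<gamma> \<noteq> null_model m \<longrightarrow> f Y (null_model m) > f Y \<gamma>"
    using that neq
    by (intro is_type_II_mle_iff[where \<delta> = "null_model m" and \<eta> = "full_model m"])
      (auto simp: model_prior_def)
  show "is_type_II_mle m (f Y) p \<longleftrightarrow> p = 1"
    if "\<forall>\<gamma>\<in>models m. \<gamma> \<noteq> full_model m \<longrightarrow> f Y (full_model m) > f Y \<gamma>"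
    using that neq
    by (intro is_type_II_mle_iff[where \<delta> = "full_model m" and \<eta> = "null_model m"])
      (auto simp: model_prior_def)
qed

end
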